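(* Let $p$ be an odd prime, let $N_{p-2}$ be the number of permutations of $p-2$ letters with an even number of ascents, and let $A=\frac{pB_{p-1}+1}{p}\in\mathbb{Z}_p$ be the Agoh–Giuga quotient. Then $$2^{p-1}\equiv1+p\bigl((2N_{p-2})_0-1\bigr)+p^2\Bigl(A\,(2N_{p-2})_0-(2N_{p-2})_0^2+(2N_{p-2})_0+(2N_{p-2})_1-2\Bigr)\pmod{p^3}.$$
   Context: For a $p$-adic integer $x$, write $x=\sum_{j\ge0}(x)_jp^j$ with digits $(x)_j\in\{0,\dots,p-1\}$. Congruences are in $\mathbb{Z}_p$. For a permutation $(i_1,\dots,i_n)$ of $\{1,\dots,n\}$, an ascent is an index $k$ with $i_{k+1}>i_k$. *)

theory Defs
  imports
    "HOL-Computational_Algebra.Computational_Algebra"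
    "HOL-Combinatorics.Permutations"
    "HOL-Number_Theory.Cong"
begin

text \<open>
  Every \<open>p\<close>-adic number considered here is rational, so the ring of \<open>p\<close>-adic integers is
  represented by its rational elements: the fractions whose denominator is prime to \<open>p\<close>.
  Since \<open>p ^ n\<close> times the \<open>p\<close>-adic integers meets the rationals exactly in
  \<open>p ^ n\<close> times this set, congruences between rationals have the same meaning in both rings.
\<close>

definition padic_Ints :: "nat \<Rightarrow> rat set" where
  "padic_Ints p = {of_int a / of_int b | a b. \<not> int p dvd b}"

definition padic_cong :: "nat \<Rightarrow> nat \<Rightarrow> rat \<Rightarrow> rat \<Rightarrow> bool" where
  "padic_cong p n x y \<longleftrightarrow> (\<exists>z\<in>padic_Ints p. x - y = of_nat p ^ n * z)"

text \<open>
  The expansion \<open>x = (\<Sum>j. d j * p ^ j)\<close>; convergence in the \<open>p\<close>-adic metric is spelled out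
  as a congruence modulo \<open>p ^ n\<close> for each partial sum.
\<close>

definition padic_expansion :: "nat \<Rightarrow> rat \<Rightarrow> (nat \<Rightarrow> nat) \<Rightarrow> bool" where
  "padic_expansion p x d \<longleftrightarrow>
     (\<forall>j. d j < p) \<and> (\<forall>n. padic_cong p n x (\<Sum>j<n. of_nat (d j) * of_nat p ^ j))"

definition padic_digit :: "nat \<Rightarrow> rat \<Rightarrow> nat \<Rightarrow> nat" where
  "padic_digit p x = (THE d. padic_expansion p x d)"

definition bernoulli :: "nat \<Rightarrow> rat" where
  "bernoulli n = fact n * fps_nth (fps_X / (fps_exp 1 - 1)) n"

definition agoh_giuga :: "nat \<Rightarrow> rat" where
  "agoh_giuga p = (of_nat p * bernoulli (p - 1) + 1) / of_nat p"

definition ascents :: "nat \<Rightarrow> (nat \<Rightarrow> nat) \<Rightarrow> nat set" where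
  "ascents n \<pi> = {k \<in> {1..<n}. \<pi> (k + 1) > \<pi> k}"

definition even_ascent_count :: "nat \<Rightarrow> nat" where
  "even_ascent_count n = card {\<pi>. \<pi> permutes {1..n} \<and> even (card (ascents n \<pi>))}"

lemma padic_cong_of_int_iff:
  assumes "prime p"
  shows "padic_cong p n (of_int a) (of_int b) \<longleftrightarrow> [a = b] (mod (int p ^ n))"
proof
  assume "padic_cong p n (of_int a) (of_int b)"
  then obtain u v where uv: "\<not> int p dvd v"
      "(of_int a - of_int b :: rat) = of_nat p ^ n * (of_int u / of_int v)"
    unfolding padic_cong_def padic_Ints_def by blast
  then have "v \<noteq> 0" by auto
  with uv have "(of_int ((a - b) * v) :: rat) = of_int (int p ^ n * u)"
    by (simp add: field_simps)
  then have "(a - b) * v = int p ^ n * u"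
    by (simp only: of_int_eq_iff)
  then have "int p ^ n dvd (a - b) * v" by simp
  moreover have "coprime (int p ^ n) v"
    using uv assms by (simp add: prime_imp_coprime)
  ultimately show "[a = b] (mod (int p ^ n))"
    by (simp add: cong_iff_dvd_diff coprime_dvd_mult_left_iff)
next
  assume "[a = b] (mod (int p ^ n))"
  then obtain k where k: "a - b = int p ^ n * k"
    by (auto simp: cong_iff_dvd_diff elim: dvdE)
  have "(of_int k :: rat) \<in> padic_Ints p"
    unfolding padic_Ints_def using assms prime_gt_1_nat[of p]
    by (intro CollectI exI[of _ k] exI[of _ 1]) auto
  moreover have "(of_int a - of_int b :: rat) = of_nat p ^ n * of_int k"
    using arg_cong[OF k, of "of_int :: int \<Rightarrow> rat"] by simp
  ultimately show "padic_cong p n (of_int a) (of_int b)"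
    unfolding padic_cong_def by blast
qed

lemma padic_expansion_of_nat_iff:
  assumes "prime p"
  shows "padic_expansion p (of_nat m) d \<longleftrightarrow> d = (\<lambda>j. m div p ^ j mod p)"
proof -
  have p: "p > 1" using assms by (rule prime_gt_1_nat)
  have cong: "padic_cong p n (of_nat m) (\<Sum>j<n. of_nat (e j) * of_nat p ^ j)
      \<longleftrightarrow> [m = (\<Sum>j<n. e j * p ^ j)] (mod (p ^ n))" for n e
    using padic_cong_of_int_iff[OF assms, of n "int m" "int (\<Sum>j<n. e j * p ^ j)"]
    by (simp flip: cong_int_iff)
  have partial: "(\<Sum>j<n. (m div p ^ j mod p) * p ^ j) = m mod p ^ n" for n
  proof (induction n)
    case (Suc n)
    have "m mod p ^ Suc n = m mod (p ^ n * p)" by (simp add: mult.commute)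
    also have "\<dots> = p ^ n * (m div p ^ n mod p) + m mod p ^ n" by (rule mod_mult2_eq)
    finally show ?case using Suc by (simp add: mult.commute)
  qed auto
  have lt: "(\<Sum>j<n. e j * p ^ j) < p ^ n" if "\<forall>j. e j < p" for e n
  proof (induction n)
    case (Suc n)
    have "(\<Sum>j<Suc n. e j * p ^ j) < (e n + 1) * p ^ n" using Suc by simp
    also have "\<dots> \<le> p * p ^ n" using that by (intro mult_right_mono) (auto simp: Suc_le_eq)
    finally show ?case by simp
  qed auto
  have "d = (\<lambda>j. m div p ^ j mod p)" if "padic_expansion p (of_nat m) d"
  proof
    fix j
    have d: "\<forall>j. d j < p" "\<And>n. [m = (\<Sum>j<n. d j * p ^ j)] (mod (p ^ n))"
      using that by (auto simp: padic_expansion_def cong)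
    have eq: "(\<Sum>j<n. d j * p ^ j) = m mod p ^ n" for n
      using d(2)[of n] lt[OF d(1), of n] by (simp add: cong_def)
    have "d j * p ^ j = (m div p ^ j mod p) * p ^ j"
      using eq[of "Suc j"] eq[of j] partial[of "Suc j"] partial[of j]
      unfolding sum.lessThan_Suc by linarith
    then show "d j = m div p ^ j mod p" using p by simp
  qed
  moreover have "padic_expansion p (of_nat m) (\<lambda>j. m div p ^ j mod p)"
    unfolding padic_expansion_def cong partial using p by (auto simp: cong_def)
  ultimately show ?thesis by blast
qed

lemma padic_digit_of_nat:
  "prime p \<Longrightarrow> padic_digit p (of_nat m) j = m div p ^ j mod p"
  by (simp add: padic_digit_def padic_expansion_of_nat_iff)

lemma bernoulli_egf:
  "Abs_fps (\<lambda>n. bernoulli n / fact n) * (fps_exp 1 - 1) = fps_X"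
proof -
  have ne: "(fps_exp 1 - 1 :: rat fps) $ 1 \<noteq> 0" by simp
  then have nz: "(fps_exp 1 - 1 :: rat fps) \<noteq> 0" by (metis fps_zero_nth)
  have "subdegree (fps_exp 1 - 1 :: rat fps) \<le> 1" by (rule subdegree_leI[OF ne])
  then have "(fps_exp 1 - 1 :: rat fps) dvd fps_X" using nz by (simp add: fps_dvd_iff)
  moreover have "Abs_fps (\<lambda>n. bernoulli n / fact n) = fps_X / (fps_exp 1 - 1)"
    by (simp add: fps_eq_iff bernoulli_def)
  ultimately show ?thesis by simp
qed

end

theory Submission
  imports Defs "HOL-Combinatorics.Multiset_Permutations" "HOL-Number_Theory.Residues"
begin

text \<open>
  Splitting a permutation at its maximum shows that the exponential generating function \<open>T\<close> of
  \<open>c n = (\<Sum>\<pi>. (-1) ^ asc \<pi>)\<close>, summed over the permutations of \<open>n\<close> letters, satisfies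
  \<open>T' = 2 T - T^2\<close>, whence \<open>T = 2 e^(2x) / (e^(2x) + 1)\<close>
  and \<open>c n = 2^(n+1) (2^(n+1) - 1) B_(n+1) / (n+1)\<close>. As \<open>2 N = (p-2)! + c (p-2)\<close>, multiplying by
  \<open>p - 1\<close> expresses \<open>2 N\<close> through \<open>(p-1)!\<close>, the Fermat quotient \<open>q\<close> of \<open>2\<close> and
  \<open>p B_(p-1) = p A - 1\<close>. Glaisher's congruence \<open>(p-1)! \<equiv> p B_(p-1) - p (mod p^2)\<close>, obtained by
  comparing both sides with \<open>(\<Sum>k<p. k^(p-1))\<close>, then gives
  \<open>2 N \<equiv> 1 + q - p (A (1 + q) - q^2 - q - 2) (mod p^2)\<close>, and this is solved for \<open>q\<close>
  modulo \<open>p^2\<close>.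
\<close>

subsection \<open>Alternating sums over ascents\<close>

text \<open>Lists replace permutations here because splitting at the maximum is then plain
  concatenation. The values are rational so that they can be compared with coefficients of
  \<open>ascent_fps\<close>.\<close>

fun ascent_sign :: "'a::linorder list \<Rightarrow> rat" where
  "ascent_sign (x # y # zs) = (if x < y then -1 else 1) * ascent_sign (y # zs)"
| "ascent_sign _ = 1"

text \<open>\<open>ascent_sign\<close> recurses from the front, while passing from
  \<open>ascents n\<close> to \<open>ascents (Suc n)\<close> adds a comparison at the end; this
  bridges the two.\<close>

lemma ascent_sign_snoc:
  "ascent_sign (xs @ [x, y]) = ascent_sign (xs @ [x]) * (if x < y then -1 else 1)"
proof (induction xs)
  case (Cons a xs)
  then show ?case by (cases xs) auto
qed simp

text \<open>The step into \<open>m\<close> is always an ascent and the step out of it never is. So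
  the only extra sign is one factor -1, present exactly when something precedes
  \<open>m\<close>.\<close>

lemma ascent_sign_split_Max:
  assumes "\<And>x. x \<in> set xs \<Longrightarrow> x < m" "\<And>y. y \<in> set ys \<Longrightarrow> y < m"
  shows "ascent_sign (xs @ m # ys) = (if xs = [] then 1 else -1) * (ascent_sign xs * ascent_sign ys)"
proof -
  have right: "ascent_sign (m # ys) = ascent_sign ys"
    using assms(2) by (cases ys) (auto dest: order.asym)
  show ?thesis using assms(1)
  proof (induction xs rule: ascent_sign.induct)
    case (1 x y zs)
    then have "ascent_sign ((y # zs) @ m # ys) = - (ascent_sign (y # zs) * ascent_sign ys)"
      by auto
    then show ?case by simp
  qed (auto simp: right)
qed

text \<open>Since \<open>m\<close> occurs exactly once, the list determines what stands before and
  after it; the set \<open>S\<close> of entries before \<open>m\<close> may be any subset of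
  \<open>A\<close>.\<close>

lemma bij_betw_permutations_of_set_insert:
  assumes "m \<notin> A"
  shows "bij_betw (\<lambda>(S, xs, ys). xs @ m # ys)
    (SIGMA S:Pow A. permutations_of_set S \<times> permutations_of_set (A - S))
    (permutations_of_set (insert m A))"
proof (rule bij_betwI')
  fix s t :: "'a set \<times> 'a list \<times> 'a list"
  assume "s \<in> (SIGMA S:Pow A. permutations_of_set S \<times> permutations_of_set (A - S))"
    and "t \<in> (SIGMA S:Pow A. permutations_of_set S \<times> permutations_of_set (A - S))"
  then show "((case s of (S, xs, ys) \<Rightarrow> xs @ m # ys) = (case t of (S, xs, ys) \<Rightarrow> xs @ m # ys)) = (s = t)"
    using assms
    by (fastforce simp: permutations_of_set_def append_Cons_eq_iff)
next
  fix s
  assume "s \<in> (SIGMA S:Pow A. permutations_of_set S \<times> permutations_of_set (A - S))"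
  then show "(case s of (S, xs, ys) \<Rightarrow> xs @ m # ys) \<in> permutations_of_set (insert m A)"
    using assms by (auto simp: permutations_of_set_def)
next
  fix zs assume zs: "zs \<in> permutations_of_set (insert m A)"
  then obtain xs ys where eq: "zs = xs @ m # ys"
    by (metis insertI1 permutations_of_setD(1) split_list)
  have "set xs \<subseteq> A" "ys \<in> permutations_of_set (A - set xs)"
    using zs assms unfolding eq permutations_of_set_def by auto
  then show "\<exists>s\<in>SIGMA S:Pow A. permutations_of_set S \<times> permutations_of_set (A - S).
      zs = (case s of (S, xs, ys) \<Rightarrow> xs @ m # ys)"
    using zs unfolding eq permutations_of_set_def by (intro bexI[of _ "(set xs, xs, ys)"]) auto
qed

lemma sum_Pow_card:
  assumes "finite A"
  shows "(\<Sum>S\<in>Pow A. f (card S)) = (\<Sum>k\<le>card A. of_nat (card A choose k) * (f k :: 'b::comm_semiring_1))"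
proof -
  have "(\<Sum>S\<in>Pow A. f (card S)) = (\<Sum>k\<le>card A. \<Sum>S\<in>{S \<in> Pow A. card S = k}. f (card S))"
    using assms by (intro sum.group[symmetric]) (auto intro: card_mono)
  also have "\<dots> = (\<Sum>k\<le>card A. of_nat (card A choose k) * f k)"
    using n_subsets[OF assms] by (intro sum.cong) auto
  finally show ?thesis .
qed

section \<open>The generating function of the alternating sums\<close>

text \<open>This series is 1 + tanh x, so beyond the constant term the alternating sums are signed
  tangent numbers.\<close>

definition ascent_fps :: "rat fps" where
  "ascent_fps = 2 * fps_exp 2 / (fps_exp 2 + 1)"

lemma ascent_fps_mult: "ascent_fps * (fps_exp 2 + 1) = 2 * fps_exp 2"
proof -
  have "(fps_exp 2 + 1 :: rat fps) $ 0 \<noteq> 0" by simp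
  then have "is_unit (fps_exp 2 + 1 :: rat fps)" by simp
  then show ?thesis unfolding ascent_fps_def by simp
qed

lemma ascent_fps_nth_0: "ascent_fps $ 0 = 1"
  using arg_cong[OF ascent_fps_mult, of "\<lambda>f. f $ 0"] by simp

lemma fps_deriv_ascent_fps: "fps_deriv ascent_fps = 2 * ascent_fps - ascent_fps ^ 2"
proof -
  let ?e = "fps_exp 2 :: rat fps"
  have const: "fps_const (2::rat) = 2" by (simp add: numeral_fps_const)
  have nz: "?e + 1 \<noteq> 0"
    by (intro fps_nonzeroI[of _ 0]) simp
  have "fps_deriv (ascent_fps * (?e + 1)) = fps_deriv (2 * ?e)" by (simp only: ascent_fps_mult)
  then have d: "fps_deriv ascent_fps * (?e + 1) = 4 * ?e - ascent_fps * (2 * ?e)"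
    by (simp add: const algebra_simps)
  \<comment> \<open>Multiplying by the square of the denominator makes both sides polynomials in
    \<open>?e\<close>, because \<open>ascent_fps\<close> then occurs only through
    \<open>ascent_fps * (?e + 1)\<close>.\<close>
  have "fps_deriv ascent_fps * (?e + 1) * (?e + 1) = (2 * ascent_fps - ascent_fps ^ 2) * (?e + 1) * (?e + 1)"
  proof -
    have "(4 * ?e - ascent_fps * (2 * ?e)) * (?e + 1) = 4 * ?e * (?e + 1) - 2 * ?e * (ascent_fps * (?e + 1))"
      by (simp add: algebra_simps)
    moreover have "(2 * ascent_fps - ascent_fps ^ 2) * (?e + 1) * (?e + 1)
        = 2 * (ascent_fps * (?e + 1)) * (?e + 1) - (ascent_fps * (?e + 1)) ^ 2"
      by (simp add: algebra_simps power2_eq_square)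
    ultimately show ?thesis unfolding d ascent_fps_mult by (simp add: algebra_simps power2_eq_square)
  qed
  then show ?thesis using nz by simp
qed

text \<open>Coefficients of T' = 2 T - T^2 are compared. As \<open>c 0 = 1\<close>, the term 2 T
  merely flips the sign of the summand k = 0 of -T^2, which matches the exceptional sign of an empty
  left part in \<open>ascent_sign_split_Max\<close>.\<close>

lemma ascent_fps_rec:
  defines "c \<equiv> \<lambda>n. fact n * ascent_fps $ n"
  shows "c (Suc n) = (\<Sum>k\<le>n. of_nat (n choose k) * ((if k = 0 then 1 else -1) * (c k * c (n - k))))"
proof -
  have sq: "fact n * (ascent_fps ^ 2) $ n = (\<Sum>k\<le>n. of_nat (n choose k) * (c k * c (n - k)))"
    unfolding power2_eq_square fps_mult_nth sum_distrib_left c_def atLeast0AtMost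
    by (intro sum.cong refl) (simp add: binomial_fact)
  have "c (Suc n) = fact n * fps_deriv ascent_fps $ n" by (simp add: c_def algebra_simps)
  also have "\<dots> = 2 * c n - fact n * (ascent_fps ^ 2) $ n"
    by (simp add: fps_deriv_ascent_fps c_def algebra_simps numeral_fps_const)
  also have "\<dots> = (\<Sum>k\<le>n. if k = 0 then 2 * c n else 0) - (\<Sum>k\<le>n. of_nat (n choose k) * (c k * c (n - k)))"
    by (simp add: sq)
  also have "\<dots> = (\<Sum>k\<le>n. of_nat (n choose k) * ((if k = 0 then 1 else -1) * (c k * c (n - k))))"
    unfolding sum_subtractf[symmetric]
    by (intro sum.cong refl) (auto simp: c_def ascent_fps_nth_0)
  finally show ?thesis .
qed

text \<open>Strong induction on the cardinality: removing the maximum factors the sum over the two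
  sides, and grouping the left sets by size gives the recurrence
  \<open>ascent_fps_rec\<close>.\<close>

lemma sum_ascent_sign:
  "finite A \<Longrightarrow> (\<Sum>xs\<in>permutations_of_set A. ascent_sign xs) = fact (card A) * ascent_fps $ card A"
proof (induction "card A" arbitrary: A rule: less_induct)
  case less
  show ?case
  proof (cases "A = {}")
    case True
    then show ?thesis by (simp add: ascent_fps_nth_0)
  next
    case False
    define m where "m = Max A"
    define B where "B = A - {m}"
    define c where "c = (\<lambda>n. fact n * ascent_fps $ n)"
    have A: "A = insert m B" and mB: "m \<notin> B" and finB: "finite B"
      using Max_in[OF less.prems False] less.prems by (auto simp: m_def B_def)
    have lt: "x < m" if "x \<in> B" for x
      using that less.prems by (auto simp: m_def B_def le_neq_trans)
    have "card A = Suc (card B)" using finB mB by (simp add: A)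
    have IH: "(\<Sum>xs\<in>permutations_of_set S. ascent_sign xs) = c (card S)" if "S \<subseteq> B" for S
      using less.hyps[of S] finite_subset[OF that finB] card_mono[OF finB that] \<open>card A = _\<close>
      by (simp add: c_def)
    have "(\<Sum>xs\<in>permutations_of_set A. ascent_sign xs) =
        (\<Sum>(S, xs, ys)\<in>(SIGMA S:Pow B. permutations_of_set S \<times> permutations_of_set (B - S)).
          ascent_sign (xs @ m # ys))"
      unfolding A by (subst sum.reindex_bij_betw[OF bij_betw_permutations_of_set_insert[OF mB], symmetric])
        (simp add: case_prod_unfold)
    also have "\<dots> = (\<Sum>S\<in>Pow B. \<Sum>xs\<in>permutations_of_set S. \<Sum>ys\<in>permutations_of_set (B - S).
          ascent_sign (xs @ m # ys))"
      using finB by (simp add: sum.Sigma sum.cartesian_product)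
    also have "\<dots> = (\<Sum>S\<in>Pow B. \<Sum>xs\<in>permutations_of_set S. \<Sum>ys\<in>permutations_of_set (B - S).
          (if S = {} then 1 else -1) * (ascent_sign xs * ascent_sign ys))"
    proof (intro sum.cong refl)
      fix S xs ys
      assume S: "S \<in> Pow B" "xs \<in> permutations_of_set S" "ys \<in> permutations_of_set (B - S)"
      then have "set xs = S" "set ys = B - S" by (auto dest: permutations_of_setD)
      with S(1) show "ascent_sign (xs @ m # ys) = (if S = {} then 1 else -1) * (ascent_sign xs * ascent_sign ys)"
        by (subst ascent_sign_split_Max) (auto intro!: lt)
    qed
    also have "\<dots> = (\<Sum>S\<in>Pow B. (if S = {} then 1 else -1) *
        ((\<Sum>xs\<in>permutations_of_set S. ascent_sign xs) * (\<Sum>ys\<in>permutations_of_set (B - S). ascent_sign ys)))"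
      by (simp only: sum_product) (simp only: sum_distrib_left)
    also have "\<dots> = (\<Sum>S\<in>Pow B. (if card S = 0 then 1 else -1) * (c (card S) * c (card B - card S)))"
    proof (intro sum.cong refl)
      fix S assume "S \<in> Pow B"
      then have "S \<subseteq> B" "finite S" using finB by (auto intro: finite_subset)
      then show "(if S = {} then 1 else -1) *
        ((\<Sum>xs\<in>permutations_of_set S. ascent_sign xs) * (\<Sum>ys\<in>permutations_of_set (B - S). ascent_sign ys))
        = (if card S = 0 then 1 else -1) * (c (card S) * c (card B - card S))"
        by (simp add: IH card_Diff_subset)
    qed
    also have "\<dots> = c (card A)"
      unfolding \<open>card A = _\<close> using ascent_fps_rec[of "card B", folded c_def]
      by (subst sum_Pow_card[OF finB, where f = "\<lambda>k. (if k = 0 then 1 else -1) * (c k * c (card B - k))"])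
         (simp add: c_def)
    finally show ?thesis by (simp add: c_def)
  qed
qed

section \<open>From lists to permutations of an initial segment\<close>

lemma ascent_sign_map_upt:
  "ascent_sign (map \<pi> [1..<Suc n]) = (-1) ^ card (ascents n \<pi>)"
proof (induction n)
  case 0
  then show ?case by (simp add: ascents_def)
next
  case (Suc n)
  show ?case
  \<comment> \<open>For n = 0 the list has a single entry; index 0 is never a position of an ascent,
    so the general step, which compares positions \<open>n\<close> and \<open>Suc n\<close>, needs n
    to be positive.\<close>
  proof (cases n)
    case 0
    then show ?thesis by (simp add: ascents_def)
  next
    case (Suc k)
    have ascents: "ascents (Suc n) \<pi> = (if \<pi> n < \<pi> (Suc n) then insert n (ascents n \<pi>) else ascents n \<pi>)"
      using Suc by (auto simp: ascents_def less_Suc_eq)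
    have "n \<notin> ascents n \<pi>" "finite (ascents n \<pi>)" by (auto simp: ascents_def)
    moreover have "ascent_sign (map \<pi> [1..<Suc (Suc n)])
        = ascent_sign (map \<pi> [1..<Suc n]) * (if \<pi> n < \<pi> (Suc n) then -1 else 1)"
      using ascent_sign_snoc[of "map \<pi> [1..<n]" "\<pi> n" "\<pi> (Suc n)"] Suc by simp
    ultimately show ?thesis by (simp add: ascents Suc.IH del: upt_Suc One_nat_def)
  qed
qed

text \<open>Surjectivity comes from counting: the map is injective into a set of the same finite
  cardinality n!.\<close>

lemma bij_betw_permutes_permutations_of_set:
  "bij_betw (\<lambda>\<pi>. map \<pi> [1..<Suc n]) {\<pi>. \<pi> permutes {1..n}} (permutations_of_set {1..n})"
proof -
  let ?f = "\<lambda>\<pi>. map \<pi> [1..<Suc n] :: nat list"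
  have inj: "inj_on ?f {\<pi>. \<pi> permutes {1..n}}"
  proof (rule inj_onI)
    fix \<pi> \<sigma> :: "nat \<Rightarrow> nat"
    assume "\<pi> \<in> {\<pi>. \<pi> permutes {1..n}}" "\<sigma> \<in> {\<pi>. \<pi> permutes {1..n}}" "?f \<pi> = ?f \<sigma>"
    then have perm: "\<pi> permutes {1..n}" "\<sigma> permutes {1..n}" and "\<And>x. x \<in> {1..n} \<Longrightarrow> \<pi> x = \<sigma> x"
      unfolding map_eq_conv by auto
    then show "\<pi> = \<sigma>"
      by (metis ext permutes_not_in)
  qed
  have "?f \<pi> \<in> permutations_of_set {1..n}" if "\<pi> permutes {1..n}" for \<pi>
  proof
    show "set (?f \<pi>) = {1..n}"
      using permutes_image[OF that] by (simp only: set_map set_upt atLeastLessThanSuc_atLeastAtMost)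
    show "distinct (?f \<pi>)"
      using permutes_inj_on[OF that] by (simp add: distinct_map del: upt_Suc)
  qed
  then have "?f ` {\<pi>. \<pi> permutes {1..n}} \<subseteq> permutations_of_set {1..n}" by blast
  moreover have "card (?f ` {\<pi>. \<pi> permutes {1..n}}) = card (permutations_of_set {1..n})"
    using inj by (simp add: card_image card_permutations)
  ultimately show ?thesis using inj
    by (simp add: bij_betw_def card_subset_eq)
qed

lemma sum_permutes_ascents:
  "(\<Sum>\<pi> | \<pi> permutes {1..n}. (-1) ^ card (ascents n \<pi>)) = fact n * ascent_fps $ n"
  using sum_ascent_sign[of "{1..n}"]
    sum.reindex_bij_betw[OF bij_betw_permutes_permutations_of_set, of ascent_sign n]
  by (simp add: ascent_sign_map_upt del: upt_Suc One_nat_def)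

text \<open>1 + (-1)^a is twice the indicator of a being even.\<close>

lemma even_ascent_count_eq:
  "2 * of_nat (even_ascent_count n) = fact n + fact n * ascent_fps $ n"
proof -
  let ?P = "{\<pi>. \<pi> permutes {1..n}}"
  have fin: "finite ?P" by (simp add: finite_permutations)
  have "2 * of_nat (even_ascent_count n) = (\<Sum>\<pi>\<in>?P. if even (card (ascents n \<pi>)) then 2 else 0 :: rat)"
    using fin by (simp add: even_ascent_count_def sum.If_cases Int_def)
  also have "\<dots> = (\<Sum>\<pi>\<in>?P. 1 + (-1) ^ card (ascents n \<pi>))"
    by (intro sum.cong) (auto simp: uminus_power_if)
  also have "\<dots> = of_nat (card ?P) + (\<Sum>\<pi>\<in>?P. (-1) ^ card (ascents n \<pi>))"
    by (simp add: sum.distrib)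
  finally show ?thesis by (simp add: sum_permutes_ascents card_permutations del: One_nat_def)
qed

subsection \<open>Bernoulli numbers\<close>

abbreviation bernoulli_fps :: "rat fps" where
  "bernoulli_fps \<equiv> Abs_fps (\<lambda>n. bernoulli n / fact n)"

text \<open>With y = e^(2x) this is the partial fraction identity 2y/(y+1) = 2 - 2/(y-1) + 4/(y^2-1)
  multiplied by x; the last two terms are the Bernoulli series at 2x and 4x.\<close>

lemma fps_X_mult_ascent_fps:
  "fps_X * ascent_fps = 
    2 * fps_X - (bernoulli_fps oo (fps_const 2 * fps_X)) + (bernoulli_fps oo (fps_const 4 * fps_X))"
proof -
  let ?e = "fps_exp 2 :: rat fps"
  have scale: "(bernoulli_fps oo (fps_const c * fps_X)) * (fps_exp c - 1) = fps_const c * fps_X" for c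
  proof -
    have "(bernoulli_fps * (fps_exp 1 - 1)) oo (fps_const c * fps_X) = fps_const c * fps_X"
      unfolding bernoulli_egf by simp
    then show ?thesis
      by (simp add: fps_compose_mult_distrib fps_compose_sub_distrib)
  qed
  have e4: "fps_exp 4 = ?e * ?e" using fps_exp_add_mult[of "2::rat" 2] by simp
  have const: "fps_const (2::rat) = 2" "fps_const (4::rat) = 4" by (simp_all add: numeral_fps_const)
  have nz1: "?e + 1 \<noteq> 0" by (intro fps_nonzeroI[of _ 0]) simp
  \<comment> \<open>This factor has constant term 0 and is not a unit; it is cancelled as a nonzero
    element of an integral domain, its coefficient of x being 2.\<close>
  have nz2: "?e - 1 \<noteq> 0" by (intro fps_nonzeroI[of _ 1]) simp
  define P where "P = bernoulli_fps oo (fps_const 2 * fps_X)"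
  define Q where "Q = bernoulli_fps oo (fps_const 4 * fps_X)"
  have P: "P * (?e - 1) = 2 * fps_X" using scale[of 2] by (simp add: P_def const)
  have Q: "Q * ((?e - 1) * (?e + 1)) = 4 * fps_X"
    using scale[of 4] by (simp add: Q_def const e4 algebra_simps)
  have "(2 * fps_X - P + Q) * ((?e - 1) * (?e + 1))
      = 2 * fps_X * ((?e - 1) * (?e + 1)) - P * (?e - 1) * (?e + 1) + Q * ((?e - 1) * (?e + 1))"
    by (simp add: algebra_simps)
  also have "\<dots> = fps_X * (2 * ?e) * (?e - 1)"
    unfolding P Q by (simp add: algebra_simps)
  also have "\<dots> = fps_X * ascent_fps * ((?e - 1) * (?e + 1))"
    unfolding ascent_fps_mult[symmetric] by (simp add: algebra_simps)
  finally have "2 * fps_X - P + Q = fps_X * ascent_fps" using nz1 nz2 by simp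
  then show ?thesis by (simp add: P_def Q_def)
qed

text \<open>The coefficient of x^(n+1) is read off; \<open>n \<ge> 1\<close> excludes the one
  coefficient to which the summand 2x contributes.\<close>

lemma ascent_fps_nth:
  assumes "n \<ge> 1"
  shows "fact n * ascent_fps $ n = 2 ^ Suc n * (2 ^ Suc n - 1) * bernoulli (Suc n) / of_nat (Suc n)"
proof -
  define s :: rat where "s = of_nat (Suc n)"
  have "s \<noteq> 0" unfolding s_def of_nat_eq_0_iff by simp
  have "ascent_fps $ n = - (2 ^ Suc n * (bernoulli (Suc n) / fact (Suc n)))
      + 2 ^ Suc n * 2 ^ Suc n * (bernoulli (Suc n) / fact (Suc n))"
  proof -
    have "(4::rat) ^ Suc n = 2 ^ Suc n * 2 ^ Suc n" unfolding power_mult_distrib[symmetric] by simp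
    moreover have "ascent_fps $ n = - (2 ^ Suc n * (bernoulli (Suc n) / fact (Suc n)))
      + 4 ^ Suc n * (bernoulli (Suc n) / fact (Suc n))"
    using arg_cong[OF fps_X_mult_ascent_fps, of "\<lambda>f. f $ Suc n"] assms
      by (simp add: numeral_fps_const del: power_Suc fact_Suc)
    ultimately show ?thesis by simp
  qed
  moreover have "fact (Suc n) = s * fact n" by (simp add: s_def)
  ultimately show ?thesis
    using \<open>s \<noteq> 0\<close> unfolding s_def[symmetric] by (simp add: divide_simps del: power_Suc fact_Suc) (simp add: algebra_simps)
qed

section \<open>Power sums and Bernoulli numbers\<close>

lemma sum_exp_fps:
  fixes x :: "'a::field_char_0"
  shows "(\<Sum>k<m. fps_exp (of_nat k)) * (fps_exp 1 - 1 :: 'a fps) = fps_exp (of_nat m) - 1"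
proof -
  have "(\<Sum>k<m. fps_exp (of_nat k)) * (fps_exp 1 - 1 :: 'a fps) = (fps_exp 1) ^ m - 1"
    by (subst power_diff_1_eq) (simp add: fps_exp_power_mult mult.commute)
  then show ?thesis by (simp add: fps_exp_power_mult)
qed

text \<open>Faulhaber's formula. The geometric sum of exponentials times x equals the Bernoulli
  series times e^(mx) - 1; the summand j = n + 1 of the product vanishes since e^(mx) - 1 has no
  constant term.\<close>

lemma power_sum_bernoulli:
  "(\<Sum>k<m. of_nat k ^ n) / fact n = (\<Sum>j\<le>n. bernoulli j / fact j * (of_nat m ^ (Suc n - j) / fact (Suc n - j)))"
proof -
  let ?E = "\<Sum>k<m. fps_exp (of_nat k) :: rat fps"
  have "(fps_X * ?E) * (fps_exp 1 - 1) = bernoulli_fps * (fps_exp (of_nat m) - 1) * (fps_exp 1 - 1)"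
    using bernoulli_egf sum_exp_fps[where 'a = rat, of m]
    by (metis (no_types) mult.assoc mult.commute)
  moreover have "fps_exp 1 - 1 \<noteq> (0 :: rat fps)" by (intro fps_nonzeroI[of _ 1]) simp
  ultimately have "fps_X * ?E = bernoulli_fps * (fps_exp (of_nat m) - 1)" by simp
  then have "(fps_X * ?E) $ Suc n = (bernoulli_fps * (fps_exp (of_nat m) - 1)) $ Suc n" by simp
  moreover have "(fps_X * ?E) $ Suc n = (\<Sum>k<m. of_nat k ^ n) / fact n"
    by (simp add: fps_sum_nth sum_divide_distrib)
  moreover have "(bernoulli_fps * (fps_exp (of_nat m) - 1)) $ Suc n
    = (\<Sum>j\<le>n. bernoulli j / fact j * (of_nat m ^ (Suc n - j) / fact (Suc n - j)))"
    unfolding fps_mult_nth by (simp add: atLeast0AtMost mult.commute)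
  ultimately show ?thesis by simp
qed

text \<open>This is Faulhaber's formula for m = 1, where the power sum is 0^n = 0.\<close>

lemma bernoulli_rec:
  assumes "n \<ge> 1"
  shows "bernoulli n / fact n = - (\<Sum>j<n. bernoulli j / fact j / fact (Suc n - j))"
proof -
  have "0 = (\<Sum>j\<le>n. bernoulli j / fact j * (1 / fact (Suc n - j)))"
    using power_sum_bernoulli[of n 1] assms by (simp add: power_0_left)
  also have "\<dots> = (\<Sum>j<n. bernoulli j / fact j / fact (Suc n - j)) + bernoulli n / fact n"
    by (simp add: lessThan_Suc_atMost[symmetric])
  finally show ?thesis by simp
qed

lemma bernoulli_0: "bernoulli 0 = 1"
  using power_sum_bernoulli[of 0 1] by simp

subsection \<open>Rational \<open>p\<close>-adic integers\<close>

lemma padic_Ints_fraction: "\<not> int p dvd b \<Longrightarrow> of_int a / of_int b \<in> padic_Ints p"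
  unfolding padic_Ints_def by blast

lemma padic_Ints_of_int:
  assumes "prime p" shows "of_int a \<in> padic_Ints p"
proof -
  have "\<not> int p dvd 1" using prime_gt_1_nat[OF assms] by simp
  then show ?thesis using padic_Ints_fraction[of p 1 a] by simp
qed

lemma padic_Ints_of_nat: "prime p \<Longrightarrow> of_nat n \<in> padic_Ints p"
  using padic_Ints_of_int[of p "int n"] by simp

lemma padic_Ints_numeral: "prime p \<Longrightarrow> numeral n \<in> padic_Ints p"
  using padic_Ints_of_nat[of p "numeral n"] by simp

lemma padic_Ints_1: "prime p \<Longrightarrow> 1 \<in> padic_Ints p"
  using padic_Ints_of_nat[of p 1] by simp

lemma padic_Ints_add:
  assumes "prime p" "x \<in> padic_Ints p" "y \<in> padic_Ints p"
  shows "x + y \<in> padic_Ints p"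
proof -
  obtain a b c d where xy: "x = of_int a / of_int b" "y = of_int c / of_int d"
    and nd: "\<not> int p dvd b" "\<not> int p dvd d"
    using assms(2,3) unfolding padic_Ints_def by blast
  then have "b \<noteq> 0" "d \<noteq> 0" by auto
  then have "x + y = of_int (a * d + c * b) / of_int (b * d)" by (simp add: xy field_simps)
  moreover have "\<not> int p dvd b * d" using nd assms(1) by (simp add: prime_dvd_mult_iff)
  ultimately show ?thesis by (metis padic_Ints_fraction)
qed

lemma padic_Ints_mult:
  assumes "prime p" "x \<in> padic_Ints p" "y \<in> padic_Ints p"
  shows "x * y \<in> padic_Ints p"
proof -
  obtain a b c d where xy: "x = of_int a / of_int b" "y = of_int c / of_int d"
    and nd: "\<not> int p dvd b" "\<not> int p dvd d"
    using assms(2,3) unfolding padic_Ints_def by blast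
  have "x * y = of_int (a * c) / of_int (b * d)" by (simp add: xy)
  moreover have "\<not> int p dvd b * d" using nd assms(1) by (simp add: prime_dvd_mult_iff)
  ultimately show ?thesis by (metis padic_Ints_fraction)
qed

lemma padic_Ints_uminus: "prime p \<Longrightarrow> x \<in> padic_Ints p \<Longrightarrow> - x \<in> padic_Ints p"
  using padic_Ints_mult[of p "of_int (-1)" x] padic_Ints_of_int[of p "-1"] by simp

lemma padic_Ints_diff:
  "prime p \<Longrightarrow> x \<in> padic_Ints p \<Longrightarrow> y \<in> padic_Ints p \<Longrightarrow> x - y \<in> padic_Ints p"
  using padic_Ints_add[of p x "- y"] padic_Ints_uminus[of p y] by simp

lemma padic_Ints_power: "prime p \<Longrightarrow> x \<in> padic_Ints p \<Longrightarrow> x ^ n \<in> padic_Ints p"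
  by (induction n) (auto intro: padic_Ints_1 padic_Ints_mult)

lemma padic_Ints_sum:
  "prime p \<Longrightarrow> (\<And>i. i \<in> I \<Longrightarrow> f i \<in> padic_Ints p) \<Longrightarrow> sum f I \<in> padic_Ints p"
  by (induction I rule: infinite_finite_induct)
     (auto intro: padic_Ints_add simp: padic_Ints_of_nat[of p 0, simplified])

lemmas padic_Ints_intros = padic_Ints_1 padic_Ints_of_nat padic_Ints_of_int padic_Ints_numeral
  padic_Ints_add padic_Ints_diff padic_Ints_mult padic_Ints_uminus padic_Ints_power

lemma padic_Ints_divide_fact:
  assumes "prime p" "n < p" "x \<in> padic_Ints p"
  shows "x / fact n \<in> padic_Ints p"
proof -
  have "\<not> p dvd fact n" using assms by (simp add: prime_dvd_fact_iff)
  then have "\<not> int p dvd int (fact n)" unfolding int_dvd_int_iff .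
  then have "of_int 1 / of_int (int (fact n)) \<in> padic_Ints p" by (rule padic_Ints_fraction)
  then have "x * (1 / fact n) \<in> padic_Ints p" using assms by (intro padic_Ints_mult) auto
  then show ?thesis by simp
qed

text \<open>The recurrence for index n divides only by factorials up to (n+1)!, which are prime to p
  as long as n + 1 < p. The bound is sharp: B_(p-1) has p in its denominator.\<close>

lemma bernoulli_divide_fact_padic_Ints:
  assumes "prime p"
  shows "n + 2 \<le> p \<Longrightarrow> bernoulli n / fact n \<in> padic_Ints p"
proof (induction n rule: less_induct)
  case (less n)
  show ?case
  proof (cases "n = 0")
    case True
    then show ?thesis using assms by (simp add: bernoulli_0 padic_Ints_1)
  next
    case False
    have "bernoulli j / fact j / fact (Suc n - j) \<in> padic_Ints p" if "j < n" for j
      using that less.prems less.IH[of j] assms by (intro padic_Ints_divide_fact[of p "Suc n - j"]) simp_all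
    then show ?thesis
      using False assms by (subst bernoulli_rec) (auto intro!: padic_Ints_uminus padic_Ints_sum)
  qed
qed

section \<open>Glaisher's congruence for (p-1)! modulo p^2\<close>

text \<open>For m < p the factorial is a unit. For m = p one factor p is lost to p!, and p^(p-1) is
  still divisible by p^2 because p is at least 3.\<close>

lemma prime_power_divide_fact:
  assumes "prime p" "odd p" "2 \<le> m" "m \<le> p"
  shows "\<exists>z\<in>padic_Ints p. of_nat p ^ m / fact m = of_nat p ^ 2 * z"
proof (cases "m = p")
  case False
  have "(of_nat p :: rat) ^ m = of_nat p ^ 2 * of_nat p ^ (m - 2)"
    using assms by (simp only: power_add[symmetric] le_add_diff_inverse)
  then show ?thesis
    using False assms
    by (intro bexI[of _ "of_nat p ^ (m - 2) / fact m"] padic_Ints_divide_fact padic_Ints_intros) auto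
next
  case True
  have "p \<ge> 3" using assms prime_ge_2_nat[of p] by (cases "p = 2") auto
  have "(of_nat p :: rat) ^ p = of_nat p * (of_nat p ^ 2 * of_nat p ^ (p - 3))"
  proof -
    have "(of_nat p :: rat) ^ p = of_nat p ^ Suc (2 + (p - 3))"
      using \<open>p \<ge> 3\<close> by (intro arg_cong[of _ _ "power _"]) simp
    then show ?thesis by (simp only: power_add power_Suc)
  qed
  moreover have "(fact p :: rat) = of_nat p * fact (p - 1)"
    using \<open>p \<ge> 3\<close> by (simp add: fact_reduce)
  ultimately have "(of_nat p :: rat) ^ m / fact m = of_nat p ^ 2 * (of_nat p ^ (p - 3) / fact (p - 1))"
    using True \<open>p \<ge> 3\<close> by simp
  then show ?thesis
    using assms \<open>p \<ge> 3\<close>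
    by (intro bexI[of _ "of_nat p ^ (p - 3) / fact (p - 1)"] padic_Ints_divide_fact padic_Ints_intros) auto
qed

text \<open>In Faulhaber's formula with n = p - 1 and m = p, the summand j = p - 1 gives p B_(p-1).
  Every other summand has p^(p-j)/(p-j)! with p - j at least 2, hence a factor p^2, times a
  p-integral coefficient.\<close>

lemma power_sum_cong_bernoulli:
  assumes "prime p" "odd p"
  shows "padic_cong p 2 (\<Sum>k<p. of_nat k ^ (p - 1)) (of_nat p * bernoulli (p - 1))"
proof -
  have "p \<ge> 2" using assms(1) by (rule prime_ge_2_nat)
  have "\<exists>z\<in>padic_Ints p. bernoulli j / fact j * (of_nat p ^ (p - j) / fact (p - j)) = of_nat p ^ 2 * z"
    if j: "j < p - 1" for j
  proof -
    obtain z where z: "z \<in> padic_Ints p" "of_nat p ^ (p - j) / fact (p - j) = of_nat p ^ 2 * z"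
      using prime_power_divide_fact[OF assms, of "p - j"] j by fastforce
    have "bernoulli j / fact j * z \<in> padic_Ints p"
      using z j assms by (intro padic_Ints_mult bernoulli_divide_fact_padic_Ints) auto
    then show ?thesis using z(2) by (intro bexI[of _ "bernoulli j / fact j * z"]) auto
  qed
  then obtain g where g: "\<And>j. j < p - 1 \<Longrightarrow> g j \<in> padic_Ints p"
    "\<And>j. j < p - 1 \<Longrightarrow> bernoulli j / fact j * (of_nat p ^ (p - j) / fact (p - j)) = of_nat p ^ 2 * g j"
    by metis
  define F :: rat where "F = fact (p - 1)"
  have F: "F \<noteq> 0" by (simp add: F_def)
  have "(\<Sum>k<p. of_nat k ^ (p - 1)) / F
      = (\<Sum>j\<le>p - 1. bernoulli j / fact j * (of_nat p ^ (p - j) / fact (p - j)))"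
    using power_sum_bernoulli[of "p - 1" p] \<open>p \<ge> 2\<close> by (simp add: F_def)
  also have "{..p - 1} = insert (p - 1) {..<p - 1}" by auto
  also have "(\<Sum>j\<in>insert (p - 1) {..<p - 1}. bernoulli j / fact j * (of_nat p ^ (p - j) / fact (p - j)))
      = bernoulli (p - 1) / F * of_nat p + (\<Sum>j<p - 1. of_nat p ^ 2 * g j)"
    using \<open>p \<ge> 2\<close> g(2) by (simp add: F_def)
  finally have "(\<Sum>k<p. of_nat k ^ (p - 1)) - of_nat p * bernoulli (p - 1)
      = of_nat p ^ 2 * (F * (\<Sum>j<p - 1. g j))"
    using F by (simp add: field_simps sum_distrib_left)
  moreover have "F * (\<Sum>j<p - 1. g j) \<in> padic_Ints p"
  proof -
    have "F \<in> padic_Ints p"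
      using padic_Ints_of_nat[OF assms(1), of "fact (p - 1)"] by (simp add: F_def)
    then show ?thesis using assms g(1) by (intro padic_Ints_mult padic_Ints_sum) auto
  qed
  ultimately show ?thesis unfolding padic_cong_def by blast
qed

lemma prod_one_plus_cong:
  "[(\<Prod>k\<in>I. 1 + x * f k) = 1 + x * (\<Sum>k\<in>I. f k)] (mod (x ^ 2 :: int))"
proof (induction I rule: infinite_finite_induct)
  case (insert i I)
  have "[(1 + x * f i) * (\<Prod>k\<in>I. 1 + x * f k) = (1 + x * f i) * (1 + x * (\<Sum>k\<in>I. f k))] (mod x ^ 2)"
    using insert.IH by (rule cong_scalar_left)
  moreover have "[(1 + x * f i) * (1 + x * (\<Sum>k\<in>I. f k)) = 1 + x * (f i + (\<Sum>k\<in>I. f k))] (mod x ^ 2)"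
    unfolding cong_iff_dvd_diff
    by (intro dvdI[of _ _ "f i * (\<Sum>k\<in>I. f k)"]) (simp add: algebra_simps power2_eq_square)
  ultimately show ?case using insert.hyps by (auto intro: cong_trans)
qed auto

text \<open>The power (p-1)!^(p-1) is computed modulo p^2 in two ways: factor by factor with k^(p-1)
  = 1 + p q_k, and from Wilson's (p-1)! = -1 + p w. This gives w = \<open>Q\<close> modulo p, and
  the power sum is p - 1 + p \<open>Q\<close>.\<close>

lemma fact_cong_power_sum:
  assumes "prime p" "odd p"
  shows "[fact (p - 1) + int p = (\<Sum>k<p. int k ^ (p - 1))] (mod (int p ^ 2))"
proof -
  have "p \<ge> 2" using assms(1) by (rule prime_ge_2_nat)
  have "\<exists>q. int k ^ (p - 1) = 1 + int p * q" if "k \<in> {1..p - 1}" for k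
  proof -
    have "\<not> p dvd k" using that \<open>p \<ge> 2\<close> by (auto dest: dvd_imp_le)
    then have "[k ^ (p - 1) = 1] (mod p)" by (rule fermat_theorem[OF assms(1)])
    then have "[int k ^ (p - 1) = 1] (mod int p)"
      using cong_int_iff[of "k ^ (p - 1)" 1 p] by simp
    then obtain q where "int k ^ (p - 1) - 1 = int p * q"
      unfolding cong_iff_dvd_diff by (rule dvdE)
    then show ?thesis by (intro exI[of _ q]) linarith
  qed
  then obtain q where q: "\<And>k. k \<in> {1..p - 1} \<Longrightarrow> int k ^ (p - 1) = 1 + int p * q k" by metis
  define Q where "Q = (\<Sum>k\<in>{1..p - 1}. q k)"
  obtain w where w: "fact (p - 1) = - 1 + int p * w"
    using wilson_theorem[OF assms(1)] unfolding cong_iff_dvd_diff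
    by (metis add.commute diff_minus_eq_add dvdE eq_diff_eq uminus_add_conv_diff)
  have "even (p - 1)" using assms by simp
  have "fact (p - 1) ^ (p - 1) = (\<Prod>k\<in>{1..p - 1}. int k ^ (p - 1))"
    by (simp add: fact_prod prod_power_distrib)
  also have "\<dots> = (\<Prod>k\<in>{1..p - 1}. 1 + int p * q k)"
    using q by (intro prod.cong) auto
  finally have 1: "[fact (p - 1) ^ (p - 1) = 1 + int p * Q] (mod (int p ^ 2))"
    using prod_one_plus_cong[of "int p" q "{1..p - 1}"] by (simp add: Q_def)
  \<comment> \<open>The exponent is even, so -1 + p w may be replaced by its negative, which has the
    shape required by \<open>prod_one_plus_cong\<close>.\<close>
  have "fact (p - 1) ^ (p - 1) = (1 + int p * (- w)) ^ (p - 1)"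
    unfolding w using power_minus_even[OF \<open>even (p - 1)\<close>, of "- 1 + int p * w"] by simp
  then have 2: "[fact (p - 1) ^ (p - 1) = 1 + int p * (int (p - 1) * - w)] (mod (int p ^ 2))"
    using prod_one_plus_cong[of "int p" "\<lambda>_. - w" "{1..p - 1}"] by simp
  have 3: "[1 + int p * (int (p - 1) * - w) = 1 + int p * w] (mod (int p ^ 2))"
    unfolding cong_iff_dvd_diff using \<open>p \<ge> 2\<close>
    by (intro dvdI[of _ _ "- w"]) (simp add: algebra_simps power2_eq_square of_nat_diff)
  have "[1 + int p * w = 1 + int p * Q] (mod (int p ^ 2))"
    using cong_trans[OF cong_sym[OF cong_trans[OF 2 3]] 1] .
  \<comment> \<open>Adding p - 2 turns the left side into (p-1)! + p and the right side into the
    power sum.\<close>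
  then have "[1 + int p * w + (int p - 2) = 1 + int p * Q + (int p - 2)] (mod (int p ^ 2))"
    by (rule cong_add) simp
  moreover have S: "(\<Sum>k<p. int k ^ (p - 1)) = 1 + int p * Q + (int p - 2)"
  proof -
    have "{..<p} = insert 0 {1..p - 1}" using \<open>p \<ge> 2\<close> by auto
    then have "(\<Sum>k<p. int k ^ (p - 1)) = (\<Sum>k\<in>{1..p - 1}. 1 + int p * q k)"
      using \<open>p \<ge> 2\<close> q by (simp add: power_0_left)
    also have "\<dots> = int (p - 1) + int p * Q" by (simp add: sum.distrib Q_def sum_distrib_left)
    finally show ?thesis using \<open>p \<ge> 2\<close> by (simp add: of_nat_diff)
  qed
  ultimately show ?thesis unfolding w S by (simp add: algebra_simps)
qed

lemma fact_cong_bernoulli: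
  assumes "prime p" "odd p"
  shows "padic_cong p 2 (fact (p - 1)) (of_nat p * bernoulli (p - 1) - of_nat p)"
proof -
  obtain z where z: "z \<in> padic_Ints p"
    "(\<Sum>k<p. of_nat k ^ (p - 1)) - of_nat p * bernoulli (p - 1) = of_nat p ^ 2 * z"
    using power_sum_cong_bernoulli[OF assms] unfolding padic_cong_def by blast
  obtain k where "fact (p - 1) + int p - (\<Sum>k<p. int k ^ (p - 1)) = int p ^ 2 * k"
    using fact_cong_power_sum[OF assms] unfolding cong_iff_dvd_diff by (rule dvdE)
  from arg_cong[OF this, of "of_int :: int \<Rightarrow> rat"]
  have "fact (p - 1) + of_nat p - (\<Sum>k<p. of_nat k ^ (p - 1)) = (of_nat p :: rat) ^ 2 * of_int k"
    by simp
  then have "fact (p - 1) - (of_nat p * bernoulli (p - 1) - of_nat p) = of_nat p ^ 2 * (of_int k + z)"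
    using z(2) by (simp add: algebra_simps)
  moreover have "of_int k + z \<in> padic_Ints p"
    using assms z(1) by (intro padic_Ints_intros)
  ultimately show ?thesis unfolding padic_cong_def by blast
qed

text \<open>Glaisher's congruence read modulo p, together with Wilson's theorem, shows that p
  divides p B_(p-1) + 1.\<close>

lemma agoh_giuga_padic_Ints:
  assumes "prime p" "odd p"
  shows "agoh_giuga p \<in> padic_Ints p"
proof -
  have "p > 0" using assms(1) by (rule prime_gt_0_nat)
  obtain z where z: "z \<in> padic_Ints p"
    "fact (p - 1) - (of_nat p * bernoulli (p - 1) - of_nat p) = of_nat p ^ 2 * z"
    using fact_cong_bernoulli[OF assms] unfolding padic_cong_def by blast
  obtain w where "fact (p - 1) - (- 1) = int p * w"
    using wilson_theorem[OF assms(1)] unfolding cong_iff_dvd_diff by (rule dvdE)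
  from arg_cong[OF this, of "of_int :: int \<Rightarrow> rat"]
  have "fact (p - 1) = of_nat p * of_int w - (1 :: rat)" by simp
  with z(2) have "of_nat p * bernoulli (p - 1) + 1 = of_nat p * (of_int w + 1 - of_nat p * z)"
    by (simp add: algebra_simps power2_eq_square)
  then have "agoh_giuga p = of_int w + 1 - of_nat p * z"
    using \<open>p > 0\<close> by (simp add: agoh_giuga_def)
  also have "\<dots> \<in> padic_Ints p"
    using assms z(1) by (intro padic_Ints_intros)
  finally show ?thesis .
qed

section \<open>Solving for the Fermat quotient\<close>

theorem theorem9:
  fixes p N :: nat and A :: rat and d :: "nat \<Rightarrow> rat"
  assumes "prime p" and "odd p"
    and "N = even_ascent_count (p - 2)"
    and "A = agoh_giuga p"
    and "\<And>j. d j = of_nat (padic_digit p (of_nat (2 * N)) j)"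
  shows "A \<in> padic_Ints p \<and>
    padic_cong p 3 (2 ^ (p - 1))
      (1 + of_nat p * (d 0 - 1) + of_nat p ^ 2 * (A * d 0 - (d 0) ^ 2 + d 0 + d 1 - 2))"
proof
  have "p \<ge> 3" using assms(1,2) prime_ge_2_nat[of p] by (cases "p = 2") auto
  define r :: rat where "r = of_nat p"
  define B where "B = bernoulli (p - 1)"
  have "r \<noteq> 0" and r1: "r - 1 \<noteq> 0" using \<open>p \<ge> 3\<close> by (auto simp: r_def)
  show A: "A \<in> padic_Ints p" using agoh_giuga_padic_Ints assms by simp
  have B: "r * B = r * A - 1"
    using \<open>r \<noteq> 0\<close> by (simp add: assms(4) agoh_giuga_def r_def B_def)

  obtain z where z: "z \<in> padic_Ints p" "fact (p - 1) - (r * B - r) = r ^ 2 * z"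
    using fact_cong_bernoulli[OF assms(1,2)] unfolding padic_cong_def r_def B_def by blast

  have "\<not> p dvd 2" using \<open>p \<ge> 3\<close> by (auto dest: dvd_imp_le)
  then have "[2 ^ (p - 1) = 1] (mod p)" by (rule fermat_theorem[OF assms(1)])
  then have "[2 ^ (p - 1) = 1] (mod int p)"
    using cong_int_iff[of "2 ^ (p - 1)" 1 p] by simp
  then obtain q' where "2 ^ (p - 1) - 1 = int p * q'"
    unfolding cong_iff_dvd_diff by (rule dvdE)
  from arg_cong[OF this, of "of_int :: int \<Rightarrow> rat"]
  have q: "2 ^ (p - 1) = 1 + r * of_int q'" by (simp add: r_def)
  define q :: rat where "q = of_int q'"

  define u :: rat where "u = of_nat (2 * N)"
  have "fact (p - 1) = (r - 1) * fact (p - 2)"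
    using fact_reduce[of "p - 1", where 'a = rat] \<open>p \<ge> 3\<close>
    by (simp add: r_def of_nat_diff numeral_2_eq_2)
  moreover have "fact (p - 2) * ascent_fps $ (p - 2) = 2 ^ (p - 1) * (2 ^ (p - 1) - 1) * B / (r - 1)"
  proof -
    have "Suc (p - 2) = p - 1" using \<open>p \<ge> 3\<close> by simp
    then show ?thesis
      using ascent_fps_nth[of "p - 2"] \<open>p \<ge> 3\<close> by (simp add: B_def r_def of_nat_diff)
  qed
  moreover have "u = fact (p - 2) + fact (p - 2) * ascent_fps $ (p - 2)"
    using even_ascent_count_eq[of "p - 2"] by (simp add: u_def assms(3))
  \<comment> \<open>Multiplying by p - 1 completes (p-2)! to (p-1)! and clears the denominator of
    B_(p-1)/(p-1).\<close>
  ultimately have "(r - 1) * u = fact (p - 1) + 2 ^ (p - 1) * (2 ^ (p - 1) - 1) * B"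
    using r1 by (simp only: distrib_left) simp
  then have u': "(r - 1) * u = fact (p - 1) + (1 + r * q) * (r * q) * B"
    by (simp only: q q_def[symmetric]) simp
  \<comment> \<open>\<open>B\<close> itself is not p-integral, but the factor r of 2^(p-1) - 1 = r q
    combines with it to r A - 1.\<close>
  then have u: "(r - 1) * u = r * A - 1 - r + r ^ 2 * z + (1 + r * q) * q * (r * A - 1)"
  proof -
    have "fact (p - 1) = r * A - 1 - r + r ^ 2 * z"
      using z(2) unfolding B by linarith
    moreover have "(1 + r * q) * (r * q) * B = (1 + r * q) * q * (r * A - 1)"
      unfolding B[symmetric] by simp
    ultimately show ?thesis using u' by simp
  qed

  \<comment> \<open>The number 2 N is natural, so its p-adic digits are its base p digits and
    \<open>v\<close> is an exact remainder after two of them.\<close>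
  define v :: rat where "v = of_nat (2 * N div p div p)"
  have d: "d j = of_nat (2 * N div p ^ j mod p)" for j
    by (simp only: assms(5) padic_digit_of_nat[OF assms(1)])
  have uv: "u = d 0 + r * d 1 + r ^ 2 * v"
  proof -
    have "2 * N = 2 * N mod p + p * (2 * N div p mod p + p * (2 * N div p div p))"
      by (simp only: mod_mult_div_eq)
    from arg_cong[OF this, of "of_nat :: nat \<Rightarrow> rat"]
    show ?thesis
      by (simp only: u_def d v_def r_def of_nat_add of_nat_mult power_0 div_by_1 power_one_right
          power2_eq_square distrib_left mult.assoc add.assoc)
  qed

  \<comment> \<open>\<open>Y\<close> collects the higher terms: (r - 1) u = -(1 + q) + r Y. Likewise
    \<open>t\<close> is chosen so that d 0 = 1 + q + r t, and it is built without division, hence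
    p-integral.\<close>
  define Y where "Y = A * (1 + q) - 1 - q ^ 2 + r * (z + A * q ^ 2)"
  define t where "t = r * u + (1 + q) - (1 + r) * Y - d 1 - r * v"
  have d0: "d 0 = 1 + q + r * t"
  proof -
    \<comment> \<open>-(1 + r) inverts r - 1 modulo r^2; exactly, u = r^2 u - (1 + r)(r - 1)
      u.\<close>
    have "d 0 = r ^ 2 * u - (1 + r) * ((r - 1) * u) - r * d 1 - r ^ 2 * v"
      using uv by (simp add: algebra_simps power2_eq_square)
    then show ?thesis
      unfolding u by (simp add: t_def Y_def algebra_simps power2_eq_square)
  qed
  have d1: "d 1 = r * u + (1 + q) - (1 + r) * Y - r * v - t" by (simp add: t_def)
  \<comment> \<open>The r^2 t coming from r (d 0 - 1) cancels the -t in d 1, and \<open>Y\<close>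
    cancels the remaining terms of order r^2, which leaves a multiple of r^3.\<close>
  have "2 ^ (p - 1) - (1 + r * (d 0 - 1) + r ^ 2 * (A * d 0 - (d 0) ^ 2 + d 0 + d 1 - 2))
      = r ^ 3 * (z + A * q ^ 2 - u + Y + v - t * (A - 2 * (1 + q) - r * t + 1))"
    unfolding q q_def[symmetric] d0 d1 Y_def
    by (simp add: algebra_simps power2_eq_square power3_eq_cube)
  moreover have "z + A * q ^ 2 - u + Y + v - t * (A - 2 * (1 + q) - r * t + 1) \<in> padic_Ints p"
    unfolding t_def Y_def q_def u_def v_def r_def d using assms(1) A z(1)
    by (intro padic_Ints_intros)
  ultimately show "padic_cong p 3 (2 ^ (p - 1))
      (1 + of_nat p * (d 0 - 1) + of_nat p ^ 2 * (A * d 0 - (d 0) ^ 2 + d 0 + d 1 - 2))"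
    unfolding padic_cong_def r_def by blast
qed

end
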